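(* Let $A=[a_{ij}]\in\mathbb{C}^{n\times n}$ and let $S$ be any nonempty proper subset of $N=\{1,\dots,n\}$, with complement $\overline{S}=N\setminus S$. Then \[ \sigma(A)\subseteq \widehat{\Xi}^{S}(A):=\bigcup_{i\in S,\ j\in\overline{S}}\Big(W_{ij}^S(A)\setminus \Psi_{ij}^S(A)\Big). \]
   Context: $\sigma(A)$ denotes the set of all eigenvalues of $A$. For $i\in N=\{1,\dots,n\}$ and $T\subseteq N$ put $r_i^T=r_i^T(A)=\sum_{j\in T\setminus\{i\}}|a_{ij}|$ (used for $T=S$ and $T=\overline{S}$). For $i\in S$, $j\in\overline{S}$ define \[ W_{ij}^S(A)=\Big\{z\in\mathbb{C}: \max\{0,|z-a_{ii}|-r_i^S\}\cdot\max\{0,|z-a_{jj}|-r_j^{\overline{S}}\}\le r_i^{\overline{S}}\,r_j^S\Big\}, \] \[ \Psi_{ij}^S(A)=\Big\{z\in\mathbb{C}: \big(|z-a_{ii}|+r_i^S\big)\big(|z-a_{jj}|+r_j^{\overline{S}}\big)<\max\{0,2|a_{ij}|-r_i^{\overline{S}}\}\cdot\max\{0,2|a_{ji}|-r_j^S\}\Big\}. \] *)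

theory Defs
  imports Complex_Main "Jordan_Normal_Form.Spectral_Radius"
begin

text \<open>
  Matrices of the type \<open>complex mat\<close> are indexed from 0, so the index set
  \<open>N = {1, ..., n}\<close> becomes \<open>{0..<n}\<close>, where \<open>n = dim_row A\<close> for a square matrix.
\<close>

definition index_compl :: "complex mat \<Rightarrow> nat set \<Rightarrow> nat set" where
  "index_compl A S = {0..<dim_row A} - S"

definition partial_row_sum :: "complex mat \<Rightarrow> nat set \<Rightarrow> nat \<Rightarrow> real" where
  "partial_row_sum A T i = (\<Sum>j\<in>T - {i}. cmod (A $$ (i, j)))"

definition W_region :: "complex mat \<Rightarrow> nat set \<Rightarrow> nat \<Rightarrow> nat \<Rightarrow> complex set" where
  "W_region A S i j =
    {z. max 0 (cmod (z - A $$ (i, i)) - partial_row_sum A S i)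
        * max 0 (cmod (z - A $$ (j, j)) - partial_row_sum A (index_compl A S) j)
      \<le> partial_row_sum A (index_compl A S) i * partial_row_sum A S j}"

definition Psi_region :: "complex mat \<Rightarrow> nat set \<Rightarrow> nat \<Rightarrow> nat \<Rightarrow> complex set" where
  "Psi_region A S i j =
    {z. (cmod (z - A $$ (i, i)) + partial_row_sum A S i)
        * (cmod (z - A $$ (j, j)) + partial_row_sum A (index_compl A S) j)
      < max 0 (2 * cmod (A $$ (i, j)) - partial_row_sum A (index_compl A S) i)
        * max 0 (2 * cmod (A $$ (j, i)) - partial_row_sum A S j)}"

definition Xi_hat :: "complex mat \<Rightarrow> nat set \<Rightarrow> complex set" where
  "Xi_hat A S = (\<Union>i\<in>S. \<Union>j\<in>index_compl A S. W_region A S i j - Psi_region A S i j)"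

end

theory Submission
  imports Defs
begin

text \<open>
  Let \<open>x\<close> be an eigenvector for \<open>z\<close> and choose \<open>i \<in> S\<close> and \<open>j \<notin> S\<close> maximizing \<open>\<bar>x i\<bar>\<close> and
  \<open>\<bar>x j\<bar>\<close>. The single pair \<open>(i, j)\<close> serves for both regions: the triangle inequality applied to
  rows \<open>i\<close> and \<open>j\<close>, solved for the diagonal term, gives two estimates relating \<open>\<bar>x i\<bar>\<close> and
  \<open>\<bar>x j\<bar>\<close> whose product is the condition defining \<open>W\<close>; solved for the terms \<open>a\<^sub>i\<^sub>j x\<^sub>j\<close> and
  \<open>a\<^sub>j\<^sub>i x\<^sub>i\<close> instead, it gives two estimates whose product excludes \<open>\<Psi>\<close>.
\<close>

text \<open>Multiply the two estimates and cancel \<open>p * q\<close>. If \<open>p\<close> or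
  \<open>q\<close> vanishes, cancellation fails, but then one estimate forces \<open>c = 0\<close>
  or \<open>a = 0\<close>, so the left side is zero.\<close>

lemma mult_le_mult_cross:
  fixes a b c d p q :: real
  assumes "a * p \<le> b * q" and "c * q \<le> d * p"
    and nonneg: "a \<ge> 0" "b \<ge> 0" "c \<ge> 0" "d \<ge> 0" "p \<ge> 0" "q \<ge> 0"
    and "p \<noteq> 0 \<or> q \<noteq> 0"
  shows "a * c \<le> b * d"
proof -
  consider "p = 0" "q > 0" | "q = 0" "p > 0" | "p > 0" "q > 0"
    using assms by linarith
  then show ?thesis
  proof cases
    case 1
    then have "c = 0"
      using assms(2) nonneg by (simp add: mult_le_0_iff)
    then show ?thesis
      using nonneg by simp
  next
    case 2
    then have "a = 0"
      using assms(1) nonneg by (simp add: mult_le_0_iff)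
    then show ?thesis
      using nonneg by simp
  next
    case 3
    have "(a * p) * (c * q) \<le> (b * q) * (d * p)"
      by (rule mult_mono) (use assms in auto)
    then have "(a * c) * (p * q) \<le> (b * d) * (p * q)"
      by (simp add: mult_ac)
    then show ?thesis
      using 3 by (simp add: mult_le_cancel_right)
  qed
qed

lemma partial_row_sum_nonneg: "0 \<le> partial_row_sum A T i"
  unfolding partial_row_sum_def by (intro sum_nonneg) simp

lemma cmod_row_sum_le:
  fixes A :: "complex mat"
  assumes "\<And>k. k \<in> T \<Longrightarrow> cmod (x k) \<le> p"
  shows "cmod (\<Sum>k\<in>T - {i}. A $$ (i, k) * x k) \<le> partial_row_sum A T i * p"
  unfolding partial_row_sum_def sum_distrib_right
  using assms by (intro sum_norm_le) (auto simp: norm_mult intro!: mult_left_mono)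

text \<open>Keeping the two blocks \<open>T\<close> and \<open>U\<close> generic lets the same
  estimates serve row \<open>i\<close> of \<open>S\<close> and, with the blocks exchanged, row
  \<open>j\<close> of the complement.\<close>

lemma eigen_row_bounds:
  fixes A :: "complex mat"
  assumes fin: "finite T" "finite U" and disj: "T \<inter> U = {}" and i: "i \<in> T" and j: "j \<in> U"
    and row: "(\<Sum>k\<in>T \<union> U. A $$ (i, k) * x k) = z * x i"
    and maxT: "\<And>k. k \<in> T \<Longrightarrow> cmod (x k) \<le> cmod (x i)"
    and maxU: "\<And>k. k \<in> U \<Longrightarrow> cmod (x k) \<le> cmod (x j)"
  shows "max 0 (cmod (z - A $$ (i, i)) - partial_row_sum A T i) * cmod (x i)
           \<le> partial_row_sum A U i * cmod (x j)"
    and "max 0 (2 * cmod (A $$ (i, j)) - partial_row_sum A U i) * cmod (x j)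
           \<le> (cmod (z - A $$ (i, i)) + partial_row_sum A T i) * cmod (x i)"
proof -
  let ?f = "\<lambda>k. A $$ (i, k) * x k"
  let ?d = "z - A $$ (i, i)"
  \<comment> \<open>Hence \<open>U - {i} = U\<close>, so \<open>partial_row_sum A U i\<close> covers
    every entry of row \<open>i\<close> in the columns of \<open>U\<close>.\<close>
  have iU: "i \<notin> U"
    using i disj by auto
  define s where "s = sum ?f (T - {i})"
  define t where "t = sum ?f U"
  define t' where "t' = sum ?f (U - {j})"
  have "sum ?f (T \<union> U) = ?f i + s + t"
    unfolding s_def t_def
    using fin disj i by (simp add: sum.union_disjoint sum.remove)
  then have eq1: "?d * x i = s + t"
    using row by (simp add: algebra_simps)
  have eq2: "t = ?f j + t'"
    unfolding t_def t'_def using fin j by (simp add: sum.remove)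
  have s: "cmod s \<le> partial_row_sum A T i * cmod (x i)"
    unfolding s_def using maxT by (rule cmod_row_sum_le)
  have t: "cmod t \<le> partial_row_sum A U i * cmod (x j)"
    using cmod_row_sum_le[of U x "cmod (x j)" A i] maxU iU unfolding t_def by simp
  have "cmod t' \<le> (\<Sum>k\<in>U - {j}. cmod (A $$ (i, k)) * cmod (x j))"
    unfolding t'_def
    using maxU by (intro sum_norm_le) (auto simp: norm_mult intro!: mult_left_mono)
  \<comment> \<open>Origin of the factor 2 in the second bound: \<open>t'\<close> omits column
    \<open>j\<close>, so moving its bound to the left adds a second copy of the modulus of the
    \<open>(i, j)\<close> entry.\<close>
  also have "\<dots> = (partial_row_sum A U i - cmod (A $$ (i, j))) * cmod (x j)"
    unfolding partial_row_sum_def using fin j iU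
    by (simp add: sum_diff1 flip: sum_distrib_right)
  finally have t': "cmod t' \<le> (partial_row_sum A U i - cmod (A $$ (i, j))) * cmod (x j)" .
  have "cmod ?d * cmod (x i) \<le> cmod s + cmod t"
    using norm_triangle_ineq[of s t] by (simp flip: norm_mult eq1)
  then have "(cmod ?d - partial_row_sum A T i) * cmod (x i) \<le> partial_row_sum A U i * cmod (x j)"
    using s t by (simp add: algebra_simps)
  \<comment> \<open>Truncating the left factor at 0 is harmless because the right side is
    nonnegative.\<close>
  then show "max 0 (cmod ?d - partial_row_sum A T i) * cmod (x i)
      \<le> partial_row_sum A U i * cmod (x j)"
    by (auto simp: max_def intro!: mult_nonneg_nonneg partial_row_sum_nonneg)
  have "?f j = ?d * x i - s - t'"
    using eq1 eq2 by (simp add: algebra_simps)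
  then have "cmod (?f j) \<le> cmod (?d * x i) + cmod s + cmod t'"
    by (metis norm_triangle_ineq4 add_right_mono order_trans)
  then have "cmod (A $$ (i, j)) * cmod (x j) \<le> cmod ?d * cmod (x i) + cmod s + cmod t'"
    by (simp only: norm_mult)
  then have "(2 * cmod (A $$ (i, j)) - partial_row_sum A U i) * cmod (x j)
      \<le> (cmod ?d + partial_row_sum A T i) * cmod (x i)"
    using s t' by (simp add: algebra_simps)
  then show "max 0 (2 * cmod (A $$ (i, j)) - partial_row_sum A U i) * cmod (x j)
      \<le> (cmod ?d + partial_row_sum A T i) * cmod (x i)"
    by (auto simp: max_def intro!: mult_nonneg_nonneg add_nonneg_nonneg partial_row_sum_nonneg)
qed

lemma finite_maximizer:
  fixes f :: "'a \<Rightarrow> 'b :: linorder"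
  assumes "finite T" and "T \<noteq> {}"
  obtains i where "i \<in> T" and "\<And>k. k \<in> T \<Longrightarrow> f k \<le> f i"
proof -
  have "Max (f ` T) \<in> f ` T"
    using assms by simp
  then obtain i where "i \<in> T" and "Max (f ` T) = f i"
    by auto
  then show thesis
    using assms by (intro that[of i]) (auto simp flip: \<open>Max (f ` T) = f i\<close>)
qed

theorem theorem3p1:
  fixes A :: "complex mat" and n :: nat and S :: "nat set"
  assumes "A \<in> carrier_mat n n"
    and "S \<noteq> {}"
    and "S \<subset> {0..<n}"
  shows "spectrum A \<subseteq> Xi_hat A S"
proof
  fix z
  assume "z \<in> spectrum A"
  then obtain v where v: "v \<in> carrier_vec n" "v \<noteq> 0\<^sub>v n" and ev: "A *\<^sub>v v = z \<cdot>\<^sub>v v"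
    using assms(1) unfolding spectrum_def eigenvalue_def eigenvector_def by auto
  define U where "U = index_compl A S"
  define x where "x = (\<lambda>k. v $ k)"
  have U: "U = {0..<n} - S"
    using assms(1) by (simp add: U_def index_compl_def)
  have fin: "finite S" "finite U" and SU: "S \<union> U = {0..<n}" "S \<inter> U = {}" and "U \<noteq> {}"
    using assms(3) finite_subset[of S "{0..<n}"] by (auto simp: U)
  have row: "(\<Sum>k\<in>S \<union> U. A $$ (l, k) * x k) = z * x l" if "l \<in> S \<union> U" for l
  proof -
    have "l < n"
      using that SU by auto
    then have "(A *\<^sub>v v) $ l = (\<Sum>k = 0..<n. A $$ (l, k) * x k)"
      using assms(1) v(1) by (simp add: scalar_prod_def x_def)
    then show ?thesis
      using \<open>l < n\<close> v(1) by (simp add: SU ev x_def)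
  qed
  obtain i where i: "i \<in> S" and maxS: "\<And>k. k \<in> S \<Longrightarrow> cmod (x k) \<le> cmod (x i)"
    using finite_maximizer[OF fin(1) assms(2), of "\<lambda>k. cmod (x k)"] by blast
  obtain j where j: "j \<in> U" and maxU: "\<And>k. k \<in> U \<Longrightarrow> cmod (x k) \<le> cmod (x j)"
    using finite_maximizer[OF fin(2) \<open>U \<noteq> {}\<close>, of "\<lambda>k. cmod (x k)"] by blast
  \<comment> \<open>An eigenvector may vanish on one whole block, so only one of the two maxima is
    sure to be nonzero. If both were zero, maximality would give \<open>v = 0\<close>.\<close>
  have "x i \<noteq> 0 \<or> x j \<noteq> 0"
  proof (rule ccontr)
    assume "\<not> ?thesis"
    then have "x k = 0" if "k \<in> S \<union> U" for k
      using that maxS[of k] maxU[of k] by auto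
    then have "v = 0\<^sub>v n"
      using v(1) by (intro eq_vecI) (auto simp: SU x_def)
    then show False
      using v(2) by simp
  qed
  then have nz: "cmod (x i) \<noteq> 0 \<or> cmod (x j) \<noteq> 0"
    by simp
  have row': "(\<Sum>k\<in>U \<union> S. A $$ (j, k) * x k) = z * x j"
    using row[of j] j by (simp add: Un_commute)
  note bi = eigen_row_bounds[OF fin SU(2) i j row maxS maxU]
  \<comment> \<open>The blocks are exchanged here. The open premise is
    \<open>U \<inter> S = {}\<close>, which follows from \<open>SU(2)\<close> below.\<close>
  note bj = eigen_row_bounds[OF fin(2,1) _ j i row' maxU maxS]
  have "z \<in> W_region A S i j"
    unfolding W_region_def mem_Collect_eq U_def[symmetric]
    using nz i SU(2)
    by (intro mult_le_mult_cross[OF bi(1) bj(1)]) (auto simp: partial_row_sum_nonneg)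
  \<comment> \<open>Compared with the case of \<open>W_region\<close>, the maxima trade places:
    \<open>p\<close> is now \<open>cmod (x j)\<close> and \<open>q\<close> is
    \<open>cmod (x i)\<close>.\<close>
  moreover have "z \<notin> Psi_region A S i j"
    unfolding Psi_region_def mem_Collect_eq U_def[symmetric] not_less
    using nz i SU(2)
    by (intro mult_le_mult_cross[OF bi(2) bj(2)]) (auto simp: partial_row_sum_nonneg)
  ultimately show "z \<in> Xi_hat A S"
    using i j unfolding Xi_hat_def U_def by blast
qed

end
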